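(* Let $\boldsymbol{X}\in\mathbb{R}^{N\times P}$ and let $\boldsymbol{W}_\ell\in\mathbb{R}^{N_{\ell-1}\times N_\ell}$, $\ell=1,\dots,L$, with $N_0=N$, be the weight matrices of a ReLU network with $\|\boldsymbol{W}_\ell\|_1=1$ for $\ell=1,\dots,L$, and let the layer outcomes be $\boldsymbol{X}^{(0)}=\boldsymbol{X}$, $\boldsymbol{X}^{(\ell)}=\mathrm{ReLU}(\boldsymbol{W}_\ell^\top\boldsymbol{X}^{(\ell-1)})$ for $\ell=1,\dots,L$. Let $\epsilon_1,\dots,\epsilon_L\ge 0$, and for each $\ell=1,\dots,L$ let $\hat{\boldsymbol{W}}_\ell$ be a solution of the convex program $$\hat{\boldsymbol{W}}_\ell\in\operatorname*{arg\,min}_{\boldsymbol{U}}\ \|\boldsymbol{U}\|_1\quad\text{subject to}\quad \boldsymbol{U}\in\mathcal{C}_{\epsilon_\ell}\big(\boldsymbol{X}^{(\ell-1)},\boldsymbol{X}^{(\ell)},\boldsymbol{0}\big).$$ Let the outcomes of the retrained network be $\hat{\boldsymbol{X}}^{(0)}=\boldsymbol{X}$ and $\hat{\boldsymbol{X}}^{(\ell)}=\mathrm{ReLU}(\hat{\boldsymbol{W}}_\ell^\top\hat{\boldsymbol{X}}^{(\ell-1)})$ for $\ell=1,\dots,L$. Then $$\big\|\hat{\boldsymbol{X}}^{(\ell)}-\boldsymbol{X}^{(\ell)}\big\|_F\le\sum_{j=1}^{\ell}\epsilon_j,\qquad \ell=1,\dots,L.$$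
   Context: $\mathrm{ReLU}$ acts entrywise: $(\mathrm{ReLU}(\boldsymbol{X}))_{m,n}=\max(x_{m,n},0)$. For a matrix, $\|\boldsymbol{X}\|_1=\sum_{m,n}|x_{m,n}|$ is the sum of absolute values of the entries (not the induced norm), and $\|\cdot\|_F$ is the Frobenius norm. For an index set $\Omega$ of entries, $\boldsymbol{W}_\Omega$ is the matrix of the same size as $\boldsymbol{W}$ that agrees with $\boldsymbol{W}$ on $\Omega$ and is zero off $\Omega$; $\Omega^c$ is the complement of $\Omega$. For matrices $\boldsymbol{X}\in\mathbb{R}^{n\times P}$, $\boldsymbol{Y},\boldsymbol{V}\in\mathbb{R}^{m\times P}$ and $\epsilon\ge0$, let $\Omega=\operatorname{supp}\boldsymbol{Y}$ be the set of indices of nonzero entries of $\boldsymbol{Y}$. The set $\mathcal{C}_\epsilon(\boldsymbol{X},\boldsymbol{Y},\boldsymbol{V})$ consists of all $\boldsymbol{U}\in\mathbb{R}^{n\times m}$ such that $\|(\boldsymbol{U}^\top\boldsymbol{X}-\boldsymbol{Y})_\Omega\|_F\le\epsilon$ and $(\boldsymbol{U}^\top\boldsymbol{X})_{\Omega^c}\le\boldsymbol{V}_{\Omega^c}$ (entrywise). *)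

theory Defs
  imports "Jordan_Normal_Form.Matrix" "HOL-Analysis.L2_Norm"
begin

(* Rows and columns are indexed from 0; layers are indexed from 1, the input being layer 0. *)

definition mat_indices :: "'a mat \<Rightarrow> (nat \<times> nat) set" where
  "mat_indices A = {..<dim_row A} \<times> {..<dim_col A}"

definition relu :: "real mat \<Rightarrow> real mat" where
  "relu = map_mat (\<lambda>x. max x 0)"

(* Entrywise norm, not the operator norm induced by the vector 1-norm. *)
definition norm1_mat :: "real mat \<Rightarrow> real" where
  "norm1_mat A = (\<Sum>ij\<in>mat_indices A. \<bar>A $$ ij\<bar>)"

definition frobenius_norm :: "real mat \<Rightarrow> real" where
  "frobenius_norm A = L2_set (\<lambda>ij. A $$ ij) (mat_indices A)"

definition supp_mat :: "real mat \<Rightarrow> (nat \<times> nat) set" where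
  "supp_mat A = {ij \<in> mat_indices A. A $$ ij \<noteq> 0}"

(* Only the in-range part of S matters, so "- S" can serve as the complement of an index set. *)
definition restrict_mat :: "real mat \<Rightarrow> (nat \<times> nat) set \<Rightarrow> real mat" where
  "restrict_mat A S = mat (dim_row A) (dim_col A) (\<lambda>ij. if ij \<in> S then A $$ ij else 0)"

(* The order on matrices is entrywise. Intended for X, Y, V with the same number of columns and
   Y, V of the same size. *)
definition feasible_set :: "real \<Rightarrow> real mat \<Rightarrow> real mat \<Rightarrow> real mat \<Rightarrow> real mat set" where
  "feasible_set \<epsilon> X Y V =
     {U \<in> carrier_mat (dim_row X) (dim_row Y).
        frobenius_norm (restrict_mat (transpose_mat U * X - Y) (supp_mat Y)) \<le> \<epsilon> \<and>
        restrict_mat (transpose_mat U * X) (- supp_mat Y) \<le> restrict_mat V (- supp_mat Y)}"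

(* The entry W 0 of a weight family is unused. *)
primrec layer_outcome :: "(nat \<Rightarrow> real mat) \<Rightarrow> real mat \<Rightarrow> nat \<Rightarrow> real mat" where
  "layer_outcome W X 0 = X"
| "layer_outcome W X (Suc l) = relu (transpose_mat (W (Suc l)) * layer_outcome W X l)"

end

theory Submission
  imports Defs
begin

(* The original weights are feasible, so the retrained ones satisfy norm1_mat (W' l) \<le> 1.
   Since the Frobenius norm of U\<^sup>T M is at most norm1_mat U times that of M and relu is
   1-Lipschitz, the error of the previous layers is passed on without amplification; the constraint
   of the convex program bounds the error newly made in layer l by \<epsilon> l. *)

lemma L2_set_mono_abs:
  assumes "\<And>i. i \<in> K \<Longrightarrow> \<bar>f i\<bar> \<le> \<bar>g i\<bar>"
  shows "L2_set f K \<le> L2_set g K"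
  unfolding L2_set_def by (intro real_sqrt_le_mono sum_mono) (simp add: assms abs_le_square_iff[symmetric])

text \<open>Minkowski's inequality for finitely many summands, obtained by iterating the two-term
  version. It allows a matrix product, once written as a sum of simple matrices, to be bounded term
  by term.\<close>

lemma L2_set_sum_le:
  assumes "finite S"
  shows "L2_set (\<lambda>x. \<Sum>s\<in>S. f s x) K \<le> (\<Sum>s\<in>S. L2_set (f s) K)"
  using assms
proof (induction S rule: finite_induct)
  case empty
  show ?case by (simp add: L2_set_def)
next
  case (insert s S)
  then show ?case
    using L2_set_triangle_ineq[of "f s" "\<lambda>x. \<Sum>s\<in>S. f s x" K] by simp
qed

lemma finite_mat_indices [simp]: "finite (mat_indices A)"
  by (simp add: mat_indices_def)

lemma mat_indices_carrier: "A \<in> carrier_mat n m \<Longrightarrow> mat_indices A = {..<n} \<times> {..<m}"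
  by (auto simp: mat_indices_def)

lemma frobenius_norm_triangle:
  assumes "A \<in> carrier_mat n m" "B \<in> carrier_mat n m" "C \<in> carrier_mat n m"
  shows "frobenius_norm (A - C) \<le> frobenius_norm (A - B) + frobenius_norm (B - C)"
proof -
  let ?I = "{..<n} \<times> {..<m}"
  have "frobenius_norm (A - C) = L2_set (\<lambda>ij. (A - B) $$ ij + (B - C) $$ ij) ?I"
    unfolding frobenius_norm_def using assms
    by (intro L2_set_cong) (auto simp: mat_indices_def)
  also have "\<dots> \<le> L2_set (\<lambda>ij. (A - B) $$ ij) ?I + L2_set (\<lambda>ij. (B - C) $$ ij) ?I"
    by (rule L2_set_triangle_ineq)
  also have "\<dots> = frobenius_norm (A - B) + frobenius_norm (B - C)"
    using assms by (simp add: frobenius_norm_def mat_indices_def)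
  finally show ?thesis .
qed

text \<open>The matrix \<open>U\<^sup>T M\<close> is a sum over the entries of \<open>U\<close>: the entry at \<open>(k, r)\<close> contributes
  a copy of row \<open>k\<close> of \<open>M\<close>, scaled by that entry and placed in row \<open>r\<close>.\<close>
lemma frobenius_norm_transpose_mult_le:
  assumes U: "U \<in> carrier_mat n m" and M: "M \<in> carrier_mat n p"
  shows "frobenius_norm (transpose_mat U * M) \<le> norm1_mat U * frobenius_norm M"
proof -
  let ?I = "{..<m} \<times> {..<p}"
  define T where "T kr ij = (if fst ij = snd kr then U $$ kr * M $$ (fst kr, snd ij) else 0)"
    for kr ij :: "nat \<times> nat"
  have entry: "(transpose_mat U * M) $$ ij = (\<Sum>kr\<in>mat_indices U. T kr ij)" if ij_in: "ij \<in> ?I" for ij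
  proof -
    obtain i j where ij: "ij = (i, j)" "i < m" "j < p" using ij_in by auto
    \<comment> \<open>For a fixed row \<open>i\<close> of the product, only the entries in column
      \<open>i\<close> of \<open>U\<close> contribute, so the inner sum over \<open>r\<close>
      collapses to the term \<open>r = i\<close>.\<close>
    have "(\<Sum>kr\<in>mat_indices U. T kr ij)
        = (\<Sum>k<n. \<Sum>r<m. if i = r then U $$ (k, r) * M $$ (k, j) else 0)"
      unfolding mat_indices_carrier[OF U]
      by (subst sum.cartesian_product) (intro sum.cong, auto simp: T_def ij)
    also have "\<dots> = (\<Sum>k<n. U $$ (k, i) * M $$ (k, j))"
      using ij by (intro sum.cong) (auto simp: sum.delta)
    also have "\<dots> = (transpose_mat U * M) $$ ij"
      using U M ij by (simp add: scalar_prod_def atLeast0LessThan)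
    finally show ?thesis by simp
  qed
  have bound: "L2_set (T kr) ?I \<le> \<bar>U $$ kr\<bar> * frobenius_norm M" if kr: "kr \<in> mat_indices U" for kr
  proof -
    obtain k r where kr: "kr = (k, r)" "k < n" "r < m" using kr U by (auto simp: mat_indices_def)
    have "(\<Sum>ij\<in>?I. (T kr ij)\<^sup>2) = (\<Sum>i<m. \<Sum>j<p. (T kr (i, j))\<^sup>2)"
      by (simp add: sum.cartesian_product case_prod_unfold)
    \<comment> \<open>\<open>T kr\<close> vanishes outside row \<open>r\<close>, where it is a
      multiple of row \<open>k\<close> of \<open>M\<close>. Its norm is thus that of a single row of
      \<open>M\<close>, which is then enlarged to all of \<open>M\<close>.\<close>
    also have "\<dots> = (\<Sum>i<m. if i = r then \<Sum>j<p. (U $$ kr * M $$ (k, j))\<^sup>2 else 0)"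
      by (intro sum.cong) (auto simp: T_def kr)
    also have "\<dots> = (\<Sum>ij\<in>{k} \<times> {..<p}. (U $$ kr * M $$ ij)\<^sup>2)"
      using kr by (simp add: sum.cartesian_product')
    also have "\<dots> \<le> (\<Sum>ij\<in>mat_indices M. (U $$ kr * M $$ ij)\<^sup>2)"
      unfolding mat_indices_carrier[OF M] using kr by (intro sum_mono2) auto
    finally have "L2_set (T kr) ?I \<le> L2_set (\<lambda>ij. U $$ kr * M $$ ij) (mat_indices M)"
      unfolding L2_set_def by (rule real_sqrt_le_mono)
    \<comment> \<open>A scalar can be pulled out of \<open>L2_set\<close> only if it is nonnegative,
      hence the passage to the absolute value.\<close>
    also have "\<dots> \<le> L2_set (\<lambda>ij. \<bar>U $$ kr\<bar> * M $$ ij) (mat_indices M)"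
      by (intro L2_set_mono_abs) (simp add: abs_mult)
    also have "\<dots> = \<bar>U $$ kr\<bar> * frobenius_norm M"
      by (simp add: frobenius_norm_def L2_set_right_distrib)
    finally show ?thesis .
  qed
  have "frobenius_norm (transpose_mat U * M) = L2_set (\<lambda>ij. \<Sum>kr\<in>mat_indices U. T kr ij) ?I"
    unfolding frobenius_norm_def using U M entry
    by (intro L2_set_cong) (auto simp: mat_indices_def)
  also have "\<dots> \<le> (\<Sum>kr\<in>mat_indices U. L2_set (T kr) ?I)"
    by (intro L2_set_sum_le) simp
  also have "\<dots> \<le> norm1_mat U * frobenius_norm M"
    unfolding norm1_mat_def sum_distrib_right by (intro sum_mono bound)
  finally show ?thesis .
qed

lemma relu_carrier [simp]: "relu A \<in> carrier_mat n m \<longleftrightarrow> A \<in> carrier_mat n m"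
  by (auto simp: relu_def)

lemma frobenius_norm_relu_diff_le:
  assumes "A \<in> carrier_mat n m" "B \<in> carrier_mat n m"
  shows "frobenius_norm (relu A - relu B) \<le> frobenius_norm (A - B)"
proof -
  have "frobenius_norm (relu A - relu B) = L2_set (\<lambda>ij. (relu A - relu B) $$ ij) (mat_indices (A - B))"
    by (simp add: frobenius_norm_def mat_indices_def relu_def)
  also have "\<dots> \<le> frobenius_norm (A - B)"
    unfolding frobenius_norm_def using assms
    by (intro L2_set_mono_abs) (auto simp: mat_indices_def relu_def)
  finally show ?thesis .
qed

text \<open>An entry of \<open>relu A\<close> is nonzero exactly where \<open>A\<close> is positive,
  and there it equals that of \<open>A\<close>, so the residual on the support is zero; off the
  support \<open>A\<close> is nonpositive. This makes the original weights competitors in the convex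
  program.\<close>

lemma feasible_set_original:
  assumes X: "X \<in> carrier_mat n p" and W: "W \<in> carrier_mat n m" and "0 \<le> e"
  shows "W \<in> feasible_set e X (relu (transpose_mat W * X)) (0\<^sub>m m p)"
proof -
  let ?Y = "relu (transpose_mat W * X)"
  have "frobenius_norm (restrict_mat (transpose_mat W * X - ?Y) (supp_mat ?Y)) = 0"
    unfolding frobenius_norm_def L2_set_def using X W
    by (auto simp: restrict_mat_def mat_indices_def supp_mat_def relu_def max_def
        intro!: sum.neutral split: if_splits)
  moreover have "restrict_mat (transpose_mat W * X) (- supp_mat ?Y) \<le> restrict_mat (0\<^sub>m m p) (- supp_mat ?Y)"
    using X W
    by (auto simp: less_eq_mat_def restrict_mat_def mat_indices_def supp_mat_def relu_def max_def
        split: if_splits)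
  ultimately show ?thesis
    using assms by (auto simp: feasible_set_def relu_def)
qed

text \<open>Off the support of \<open>Y\<close> the constraint forces nonpositive entries, which
  \<open>relu\<close> sends to 0, the value of \<open>Y\<close> there. On the support
  \<open>Y\<close> is positive, hence fixed by \<open>relu\<close>, and the 1-Lipschitz property
  bounds the error by the constrained residual.\<close>

lemma relu_feasible_le:
  assumes X: "X \<in> carrier_mat n p" and Y: "Y \<in> carrier_mat m p"
    and nonneg: "\<And>i j. i < m \<Longrightarrow> j < p \<Longrightarrow> 0 \<le> Y $$ (i, j)"
    and U: "U \<in> feasible_set e X Y (0\<^sub>m m p)"
  shows "frobenius_norm (relu (transpose_mat U * X) - Y) \<le> e"
proof -
  let ?A = "transpose_mat U * X" and ?S = "supp_mat Y"
  have Uc: "U \<in> carrier_mat n m" using U X Y by (auto simp: feasible_set_def)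
  have le: "restrict_mat ?A (- ?S) \<le> restrict_mat (0\<^sub>m m p) (- ?S)"
    and norm: "frobenius_norm (restrict_mat (?A - Y) ?S) \<le> e"
    using U by (auto simp: feasible_set_def)
  have off: "?A $$ (i, j) \<le> 0" if "i < m" "j < p" "(i, j) \<notin> ?S" for i j
  proof -
    \<comment> \<open>Deleting \<open>index_mult_mat(1)\<close> keeps the entries of
      \<open>?A\<close> from being unfolded into scalar products.\<close>
    have "\<forall>i<m. \<forall>j<p. restrict_mat ?A (- ?S) $$ (i, j) \<le> restrict_mat (0\<^sub>m m p) (- ?S) $$ (i, j)"
      using le Uc X by (simp add: less_eq_mat_def restrict_mat_def del: index_mult_mat(1))
    then have "restrict_mat ?A (- ?S) $$ (i, j) \<le> restrict_mat (0\<^sub>m m p) (- ?S) $$ (i, j)"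
      using that by blast
    then show ?thesis using that Uc X by (simp add: restrict_mat_def del: index_mult_mat(1))
  qed
  have "\<bar>(relu ?A - Y) $$ (i, j)\<bar> \<le> \<bar>restrict_mat (?A - Y) ?S $$ (i, j)\<bar>" if ij: "i < m" "j < p" for i j
  proof (cases "(i, j) \<in> ?S")
    case True
    then show ?thesis using nonneg[OF ij] ij Uc X Y
      by (auto simp: restrict_mat_def relu_def max_def simp del: index_mult_mat(1))
  next
    case False
    then have "Y $$ (i, j) = 0" using ij Y by (auto simp: supp_mat_def mat_indices_def)
    then show ?thesis using off[OF ij False] False ij Uc X Y
      by (simp add: restrict_mat_def relu_def max_def del: index_mult_mat(1))
  qed
  then have "frobenius_norm (relu ?A - Y) \<le> frobenius_norm (restrict_mat (?A - Y) ?S)"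
    unfolding frobenius_norm_def using Uc X Y
    by (auto simp: mat_indices_def restrict_mat_def intro!: L2_set_mono_abs)
  with norm show ?thesis by simp
qed

lemma layer_outcome_carrier:
  assumes "X \<in> carrier_mat (N 0) p"
    and "\<And>k. k \<in> {1..l} \<Longrightarrow> W k \<in> carrier_mat (N (k - 1)) (N k)"
  shows "layer_outcome W X l \<in> carrier_mat (N l) p"
  using assms(2)
proof (induction l)
  case 0
  show ?case using assms(1) by simp
next
  case (Suc l)
  from Suc.prems[of "Suc l"] have "W (Suc l) \<in> carrier_mat (N l) (N (Suc l))" by simp
  moreover have "layer_outcome W X l \<in> carrier_mat (N l) p" using Suc by simp
  ultimately show ?case by auto
qed

theorem theorem1:
  fixes L P :: nat
    and N :: "nat \<Rightarrow> nat"
    and X :: "real mat"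
    and W W' :: "nat \<Rightarrow> real mat"
    and \<epsilon> :: "nat \<Rightarrow> real"
  assumes X_dim: "X \<in> carrier_mat (N 0) P"
    and W_dim: "\<And>l. l \<in> {1..L} \<Longrightarrow> W l \<in> carrier_mat (N (l - 1)) (N l)"
    and W_norm: "\<And>l. l \<in> {1..L} \<Longrightarrow> norm1_mat (W l) = 1"
    and eps_nonneg: "\<And>l. l \<in> {1..L} \<Longrightarrow> \<epsilon> l \<ge> 0"
    and W'_opt: "\<And>l. l \<in> {1..L} \<Longrightarrow>
          is_arg_min norm1_mat
            (\<lambda>U. U \<in> feasible_set (\<epsilon> l) (layer_outcome W X (l - 1)) (layer_outcome W X l)
                       (0\<^sub>m (N l) P))
            (W' l)"
  shows "\<forall>l\<in>{1..L}.
           frobenius_norm (layer_outcome W' X l - layer_outcome W X l) \<le> (\<Sum>j=1..l. \<epsilon> j)"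
proof -
  have outcome: "layer_outcome W X l \<in> carrier_mat (N l) P" if "l \<le> L" for l
    using that W_dim by (intro layer_outcome_carrier X_dim) auto
  have feasible: "W' l \<in> feasible_set (\<epsilon> l) (layer_outcome W X (l - 1)) (layer_outcome W X l) (0\<^sub>m (N l) P)"
    if "l \<in> {1..L}" for l
    using W'_opt[OF that] by (simp add: is_arg_min_def)
  have W'_dim: "W' l \<in> carrier_mat (N (l - 1)) (N l)" if "l \<in> {1..L}" for l
  proof -
    have "l - 1 \<le> L" "l \<le> L" using that by auto
    then show ?thesis
      using feasible[OF that] carrier_matD(1)[OF outcome] by (simp add: feasible_set_def)
  qed
  have outcome': "layer_outcome W' X l \<in> carrier_mat (N l) P" if "l \<le> L" for l
    using that W'_dim by (intro layer_outcome_carrier X_dim) auto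
  have W'_norm: "norm1_mat (W' l) \<le> 1" if l: "l \<in> {1..L}" for l
  proof -
    have "layer_outcome W X l = relu (transpose_mat (W l) * layer_outcome W X (l - 1))"
      using l by (cases l) auto
    then have "W l \<in> feasible_set (\<epsilon> l) (layer_outcome W X (l - 1)) (layer_outcome W X l) (0\<^sub>m (N l) P)"
      using feasible_set_original[OF outcome[of "l - 1"] W_dim[OF l] eps_nonneg[OF l]] l by auto
    \<comment> \<open>If \<open>norm1_mat (W' l)\<close> exceeded 1, the feasible matrix
      \<open>W l\<close> of norm 1 would be strictly better than the minimizer.\<close>
    then show ?thesis
      using W'_opt[OF l] W_norm[OF l] by (force simp: is_arg_min_def)
  qed
  \<comment> \<open>The claim is extended to \<open>l = 0\<close>, where both networks have the same
    input and the sum is empty, so that the induction can start there.\<close>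
  have "frobenius_norm (layer_outcome W' X l - layer_outcome W X l) \<le> (\<Sum>j=1..l. \<epsilon> j)"
    if "l \<le> L" for l
    using that
  proof (induction l)
    case 0
    show ?case by (auto simp: frobenius_norm_def L2_set_def mat_indices_def intro!: sum_nonpos)
  next
    case (Suc l)
    let ?X = "layer_outcome W X l" and ?X' = "layer_outcome W' X l" and ?U = "W' (Suc l)"
    let ?Y = "layer_outcome W X (Suc l)"
    have l: "Suc l \<in> {1..L}" using Suc.prems by simp
    have X: "?X \<in> carrier_mat (N l) P" and X': "?X' \<in> carrier_mat (N l) P"
      and Y: "?Y \<in> carrier_mat (N (Suc l)) P" and U: "?U \<in> carrier_mat (N l) (N (Suc l))"
      using outcome[of l] outcome'[of l] outcome[of "Suc l"] W'_dim[OF l] Suc.prems by simp_all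
    have UX: "transpose_mat ?U * ?X \<in> carrier_mat (N (Suc l)) P"
      and UX': "transpose_mat ?U * ?X' \<in> carrier_mat (N (Suc l)) P" using U X X' by auto
    \<comment> \<open>The input \<open>X\<close> may have negative entries, but the target
      \<open>?Y\<close> belongs to a layer of index at least 1 and is therefore an image of
      \<open>relu\<close>.\<close>
    have Y_nonneg: "0 \<le> ?Y $$ (i, j)" if "i < N (Suc l)" "j < P" for i j
      using carrier_matD[OF Y] that by (simp add: relu_def)
    \<comment> \<open>The intermediate point is \<open>relu (transpose_mat ?U * ?X)\<close>: the
      retrained weights applied to the original outcome. It separates the inherited error from the
      error of the current layer.\<close>
    have "frobenius_norm (relu (transpose_mat ?U * ?X') - relu (transpose_mat ?U * ?X))
        \<le> frobenius_norm (transpose_mat ?U * ?X' - transpose_mat ?U * ?X)"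
      by (rule frobenius_norm_relu_diff_le[OF UX' UX])
    also have "\<dots> = frobenius_norm (transpose_mat ?U * (?X' - ?X))"
      using U X X' by (subst mult_minus_distrib_mat) auto
    also have "\<dots> \<le> norm1_mat ?U * frobenius_norm (?X' - ?X)"
      using U X X' by (intro frobenius_norm_transpose_mult_le) auto
    also have "\<dots> \<le> frobenius_norm (?X' - ?X)"
      using W'_norm[OF l] by (intro mult_left_le_one_le) (auto simp: frobenius_norm_def norm1_mat_def sum_nonneg)
    also have "\<dots> \<le> (\<Sum>j=1..l. \<epsilon> j)" using Suc by simp
    finally have propagated:
      "frobenius_norm (relu (transpose_mat ?U * ?X') - relu (transpose_mat ?U * ?X)) \<le> (\<Sum>j=1..l. \<epsilon> j)" .
    have local_error: "frobenius_norm (relu (transpose_mat ?U * ?X) - ?Y) \<le> \<epsilon> (Suc l)"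
      using feasible[OF l] by (intro relu_feasible_le[OF X Y Y_nonneg]) simp_all
    have "frobenius_norm (layer_outcome W' X (Suc l) - ?Y)
        \<le> frobenius_norm (relu (transpose_mat ?U * ?X') - relu (transpose_mat ?U * ?X))
          + frobenius_norm (relu (transpose_mat ?U * ?X) - ?Y)"
      using frobenius_norm_triangle[of "relu (transpose_mat ?U * ?X')" _ _ "relu (transpose_mat ?U * ?X)" ?Y]
        UX UX' Y by simp
    with propagated local_error show ?case by simp
  qed
  then show ?thesis by simp
qed

end
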